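(* Let $G$ be a connected graph with $n$ vertices. Then $G$ is uniquely quasi-transitively colourable if and only if there exists exactly one induced proper subgraph $H$ of $G$ such that: (i) $H$ is connected; (ii) $2\leq |V(H)|\leq n-1$; and (iii) for every vertex $u\in V(G)\setminus V(H)$, if $u$ is adjacent to some vertex of $V(H)$, then $u$ is adjacent to every vertex of $V(H)$.
   Context: A quasi-transitive $2$-edge-colouring of a graph $G$ is a map $c: E(G)\to\{R,B\}$ such that for all pairs of edges $xy, yz \in E(G)$ with $c(xy)\neq c(yz)$, we have $xz\in E(G)$. It is trivial if it is constant on $E(G)$. $G$ is uniquely quasi-transitively colourable if it has exactly two nontrivial quasi-transitive $2$-edge-colourings. *)

theory Defs
  imports "Graph_Theory.Digraph_Component" "HOL-Library.FuncSet"
begin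

text \<open>
  A finite simple graph is a \<^term>\<open>pair_graph\<close>: a finite, loop-free, symmetric set of ordered pairs.
  Each undirected edge \<open>xy\<close> corresponds to the two arcs \<open>(x, y)\<close> and \<open>(y, x)\<close>, so the edge set
  consists of the unordered pairs, and colourings are maps on these.
\<close>

definition edges :: "'a pair_pre_digraph \<Rightarrow> 'a set set" where
  "edges G = {{x, y} | x y. (x, y) \<in> parcs G}"

lemma (in pair_sym_digraph) doubleton_in_edges_iff: "{x, y} \<in> edges G \<longleftrightarrow> (x, y) \<in> parcs G"
  using arcs_symmetric by (auto simp: edges_def doubleton_eq_iff)

datatype colour = Red | Blue

text \<open>
  Colourings are taken extensional (\<^term>\<open>undefined\<close> outside the edge set), so that two of them are
  equal iff they agree on all edges and counting them is meaningful.
\<close>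

definition qt_colouring :: "'a pair_pre_digraph \<Rightarrow> ('a set \<Rightarrow> colour) \<Rightarrow> bool" where
  "qt_colouring G c \<longleftrightarrow>
    c \<in> edges G \<rightarrow>\<^sub>E (UNIV :: colour set) \<and>
    (\<forall>x y z. {x, y} \<in> edges G \<and> {y, z} \<in> edges G \<and> c {x, y} \<noteq> c {y, z} \<longrightarrow> {x, z} \<in> edges G)"

definition trivial_colouring :: "'a pair_pre_digraph \<Rightarrow> ('a set \<Rightarrow> colour) \<Rightarrow> bool" where
  "trivial_colouring G c \<longleftrightarrow> (\<exists>k. \<forall>e \<in> edges G. c e = k)"

definition uniquely_qt_colourable :: "'a pair_pre_digraph \<Rightarrow> bool" where
  "uniquely_qt_colourable G \<longleftrightarrow> card {c. qt_colouring G c \<and> \<not> trivial_colouring G c} = 2"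

end

theory Submission
  imports Defs
begin

text \<open>
  Two edges \<open>xy\<close>, \<open>yz\<close> with \<open>xz\<close> not an edge must get the same colour, so the quasi-transitive
  colourings are the maps that are constant on the classes of the equivalence relation generated
  by this forcing, and \<open>G\<close> is uniquely colourable iff there are exactly two classes. The vertex set
  spanned by a class is connected and homogeneous (a module), and conversely the edges inside a
  connected module form a union of classes. The key point is that distinct classes span distinct
  vertex sets. Otherwise the edges of one class, the remaining edges and the non-edges would colour
  the complete graph on their common span without a rainbow triangle; by Gallai's theorem one of the
  three colours is disconnected, which can only be the non-edges, and then both classes would
  consist of all edges between the same two co-components.
\<close>

section \<open>Connectivity via cuts\<close>

text \<open>For symmetric \<open>R\<close> this is connectivity of the graph of \<open>R\<close> on
  \<open>V\<close>, phrased by cuts so that it applies to colour classes and edge classes alike.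
  Pairs \<open>R x x\<close> never matter, and empty or one-element sets count as connected.\<close>

definition cut_connected :: "('a \<Rightarrow> 'a \<Rightarrow> bool) \<Rightarrow> 'a set \<Rightarrow> bool" where
  "cut_connected R V \<longleftrightarrow> (\<forall>S \<subseteq> V. S \<noteq> {} \<longrightarrow> S \<noteq> V \<longrightarrow> (\<exists>x \<in> S. \<exists>y \<in> V - S. R x y))"

lemma cut_connectedD:
  assumes "cut_connected R V" "S \<subseteq> V" "S \<noteq> {}" "S \<noteq> V"
  shows "\<exists>x y. x \<in> S \<and> y \<in> V \<and> y \<notin> S \<and> R x y"
  using assms unfolding cut_connected_def by blast

lemma cut_connected_mono:
  assumes "cut_connected R V" "\<And>x y. x \<in> V \<Longrightarrow> y \<in> V \<Longrightarrow> x \<noteq> y \<Longrightarrow> R x y \<Longrightarrow> R' x y"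
  shows "cut_connected R' V"
  unfolding cut_connected_def
proof (intro allI impI)
  fix S assume S: "S \<subseteq> V" "S \<noteq> {}" "S \<noteq> V"
  then obtain x y where "x \<in> S" "y \<in> V" "y \<notin> S" "R x y"
    using cut_connectedD[OF assms(1)] by blast
  then show "\<exists>x\<in>S. \<exists>y\<in>V - S. R' x y" using assms(2) S(1) by blast
qed

text \<open>A walk from \<open>S\<close> to its complement must cross the cut; conversely, the set
  of vertices reachable from \<open>u\<close> is a cut without outgoing arcs unless it is
  everything. Non-emptiness is stated apart because \<open>cut_connected\<close> holds for the empty
  set.\<close>

lemma connected_with_proj_iff:
  fixes H :: "'a pair_pre_digraph"
  assumes "sym (parcs H)"
  shows "connected (with_proj H) \<longleftrightarrow>
    pverts H \<noteq> {} \<and> cut_connected (\<lambda>x y. (x, y) \<in> parcs H) (pverts H)"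
proof -
  have arcs: "parcs (mk_symmetric (with_proj H)) = parcs H"
    using assms by (auto simp: mk_symmetric_def dest: symD)
  have conn: "connected (with_proj H) \<longleftrightarrow> pverts H \<noteq> {} \<and>
      (\<forall>u \<in> pverts H. \<forall>v \<in> pverts H. (u, v) \<in> rtrancl_on (pverts H) (parcs H))"
    unfolding connected_def strongly_connected_def reachable_def with_proj_simps
      pverts_mk_symmetric arcs by simp
  have "(\<forall>u \<in> pverts H. \<forall>v \<in> pverts H. (u, v) \<in> rtrancl_on (pverts H) (parcs H)) \<longleftrightarrow>
      cut_connected (\<lambda>x y. (x, y) \<in> parcs H) (pverts H)" (is "?reach \<longleftrightarrow> ?cut")
  proof
    assume reach: ?reach
    show ?cut unfolding cut_connected_def
    proof (intro allI impI, rule ccontr)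
      fix S assume S: "S \<subseteq> pverts H" "S \<noteq> {}" "S \<noteq> pverts H"
        and no: "\<not> (\<exists>x\<in>S. \<exists>y\<in>pverts H - S. (x, y) \<in> parcs H)"
      obtain u v where uv: "u \<in> S" "v \<in> pverts H" "v \<notin> S" using S by blast
      then have "(u, v) \<in> rtrancl_on (pverts H) (parcs H)" using reach S(1) by blast
      then have "v \<in> S" by (induction rule: rtrancl_on_induct) (use uv no in auto)
      then show False using uv by blast
    qed
  next
    assume cut: ?cut
    show ?reach
    proof (intro ballI, rule ccontr)
      fix u v assume uv: "u \<in> pverts H" "v \<in> pverts H"
        "(u, v) \<notin> rtrancl_on (pverts H) (parcs H)"
      let ?S = "{w. (u, w) \<in> rtrancl_on (pverts H) (parcs H)}"
      have "?S \<subseteq> pverts H" using in_rtrancl_on_in_F by fastforce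
      moreover have "?S \<noteq> {}" "?S \<noteq> pverts H" using uv by auto
      ultimately obtain x y where "x \<in> ?S" "y \<in> pverts H" "y \<notin> ?S" "(x, y) \<in> parcs H"
        using cut_connectedD[OF cut] by metis
      then show False using rtrancl_on_into_rtrancl_on by fastforce
    qed
  qed
  then show ?thesis using conn by blast
qed

section \<open>Gallai's theorem on colourings without rainbow triangles\<close>

text \<open>The descent step for Gallai's theorem: if \<open>v\<close> were a cut vertex of colour
  \<open>r\<close>, then the colours \<open>p\<close> and \<open>q\<close> at \<open>v\<close> would
  both be forced onto the same pairs between components of colour \<open>r\<close>.\<close>

lemma rainbow_free_connected_remove:
  fixes f :: "'a \<Rightarrow> 'a \<Rightarrow> 'c"
  assumes sym: "\<And>x y. f x y = f y x"
    and rainbow_free: "\<And>x y z. x \<in> V \<Longrightarrow> y \<in> V \<Longrightarrow> z \<in> V \<Longrightarrow>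
      f x y = f y z \<or> f y z = f x z \<or> f x y = f x z"
    and "r \<noteq> p" "r \<noteq> q" "p \<noteq> q"
    and conn: "cut_connected (\<lambda>x y. f x y = r) V" "cut_connected (\<lambda>x y. f x y = p) V"
      "cut_connected (\<lambda>x y. f x y = q) V"
    and v: "v \<in> V"
  shows "cut_connected (\<lambda>x y. f x y = r) (V - {v})"
  unfolding cut_connected_def
proof (intro allI impI, rule ccontr)
  \<comment> \<open>The classes of \<open>E\<^sup>*\<close> on \<open>V - {v}\<close> are the
    components of colour \<open>r\<close> there; \<open>S\<close> is a union of some of them, so
    there are at least two.\<close>
  define E where "E = {(x, y). x \<in> V - {v} \<and> y \<in> V - {v} \<and> f x y = r}"
  fix S assume S: "S \<subseteq> V - {v}" "S \<noteq> {}" "S \<noteq> V - {v}"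
    and no_cut: "\<not> (\<exists>x\<in>S. \<exists>y\<in>V - {v} - S. f x y = r)"
  have S_closed: "x \<in> S \<longleftrightarrow> y \<in> S" if "(x, y) \<in> E\<^sup>*" for x y
    using that
  proof (induction rule: rtrancl_induct)
    case (step y z)
    then have "f y z = r" "f z y = r" "y \<in> V - {v}" "z \<in> V - {v}" by (auto simp: E_def sym)
    then show ?case using step(3) no_cut by blast
  qed simp
  have E_sym: "(y, x) \<in> E\<^sup>*" if "(x, y) \<in> E\<^sup>*" for x y
    using that sym_rtrancl[of E] sym by (auto simp: E_def sym_def)
  have E_in: "y \<in> V - {v}" if "(x, y) \<in> E\<^sup>*" "x \<in> V - {v}" for x y
    using that by (induction rule: rtrancl_induct) (auto simp: E_def)
  \<comment> \<open>For an \<open>r\<close>-edge inside a component and a vertex \<open>y\<close> of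
    another one, exactly one side of the triangle has colour \<open>r\<close>, so the other two
    sides agree.\<close>
  have const: "f x' y = f x y"
    if "(x, x') \<in> E\<^sup>*" "x \<in> V - {v}" "y \<in> V - {v}" "(x, y) \<notin> E\<^sup>*" for x x' y
    using that(1)
  proof (induction rule: rtrancl_induct)
    case (step x1 x2)
    have x12: "x1 \<in> V" "x2 \<in> V" "f x1 x2 = r" using step(2) by (auto simp: E_def)
    have "(x1, y) \<notin> E" "(x2, y) \<notin> E"
      using step(1,2) that(4) by (meson rtrancl.rtrancl_into_rtrancl)+
    then have "f x1 y \<noteq> r" "f x2 y \<noteq> r" using step(2) that(3) by (auto simp: E_def)
    then have "f x2 y = f x1 y"
      using rainbow_free[of x1 x2 y] x12 that(3) by auto
    then show ?case using step by simp
  qed simp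
  \<comment> \<open>Since \<open>r\<close> is connected on \<open>V\<close>, the component of
    \<open>y\<close> has an \<open>r\<close>-edge to the outside, which can only end in
    \<open>v\<close>. The triangle on \<open>w\<close>, \<open>v\<close> and that edge's other end
    \<open>y'\<close> then passes the colour of \<open>v w\<close> on to \<open>w y'\<close>, and
    \<open>const\<close> carries it to \<open>w y\<close>.\<close>
  have to_outside: "f w y = k"
    if w: "w \<in> V - {v}" "f v w = k" "k \<noteq> r" and y: "y \<in> V - {v}" "(w, y) \<notin> E\<^sup>*" for w k y
  proof -
    have "E\<^sup>* `` {y} \<subseteq> V" "E\<^sup>* `` {y} \<noteq> {}" "E\<^sup>* `` {y} \<noteq> V" using E_in y v by blast+
    then obtain y' z where yz: "(y, y') \<in> E\<^sup>*" "z \<in> V" "(y, z) \<notin> E\<^sup>*" "f y' z = r"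
      using cut_connectedD[OF conn(1)] by (metis Image_singleton_iff)
    have y': "y' \<in> V - {v}" using E_in yz y by blast
    have "z = v" using yz y' by (auto simp: E_def intro: rtrancl_into_rtrancl)
    have "(w, y') \<notin> E\<^sup>*" using yz y E_sym by (meson rtrancl_trans)
    then have "f w y' \<noteq> r" using w y' by (auto simp: E_def)
    then have "f w y' = k"
      using rainbow_free[of w v y'] w y' v yz \<open>z = v\<close> by (auto simp: sym)
    moreover have "f y' w = f y w" using const yz y w E_sym by blast
    ultimately show ?thesis using sym by metis
  qed
  \<comment> \<open>The cut around \<open>v\<close> gives it a neighbour in colour \<open>p\<close>
    and one in colour \<open>q\<close>.\<close>
  have "{v} \<subseteq> V" "{v} \<noteq> {}" "{v} \<noteq> V" using S v by auto
  then obtain w w' where w: "w \<in> V - {v}" "f v w = p" and w': "w' \<in> V - {v}" "f v w' = q"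
    using cut_connectedD[OF conn(2), of "{v}"] cut_connectedD[OF conn(3), of "{v}"] by auto
  show False
  proof (cases "(w, w') \<in> E\<^sup>*")
    case True
    \<comment> \<open>With \<open>w\<close> and \<open>w'\<close> in one component, any
      \<open>y\<close> on the other side of \<open>S\<close> lies in another one and would see them
      in different colours.\<close>
    obtain y where y: "y \<in> V - {v}" "w \<in> S \<longleftrightarrow> y \<notin> S" using S by blast
    then have "(w, y) \<notin> E\<^sup>*" using S_closed[of w y] by blast
    note y = y(1) this
    have "(w', y) \<notin> E\<^sup>*" using True y(2) by (meson rtrancl_trans)
    then have "f w y = p" "f w' y = q" using to_outside w w' y assms(3,4) by auto
    then show False using const[OF True] w y assms(5) by auto
  next
    case False
    then have "f w w' = p" "f w' w = q"
      using to_outside w w' E_sym assms(3,4) by metis+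
    then show False using sym assms(5) by metis
  qed
qed

text \<open>Deleting a vertex keeps all three colours connected, so one descends to two vertices,
  whose only pair would need several colours at once. The bound on the cardinality matters because a
  single vertex is connected in every colour.\<close>

theorem rainbow_free_imp_disconnected:
  fixes f :: "'a \<Rightarrow> 'a \<Rightarrow> 'c"
  assumes "finite V" "2 \<le> card V"
    and sym: "\<And>x y. f x y = f y x"
    and rainbow_free: "\<And>x y z. x \<in> V \<Longrightarrow> y \<in> V \<Longrightarrow> z \<in> V \<Longrightarrow>
      f x y = f y z \<or> f y z = f x z \<or> f x y = f x z"
    and distinct: "r \<noteq> p" "r \<noteq> q" "p \<noteq> q"
  shows "\<not> (cut_connected (\<lambda>x y. f x y = r) V \<and> cut_connected (\<lambda>x y. f x y = p) V \<and>
    cut_connected (\<lambda>x y. f x y = q) V)"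
  using assms(1,2) rainbow_free
proof (induction V rule: finite_psubset_induct)
  case (psubset V)
  obtain v where v: "v \<in> V" using psubset.prems(1) by fastforce
  show ?case
  proof
    assume "cut_connected (\<lambda>x y. f x y = r) V \<and> cut_connected (\<lambda>x y. f x y = p) V \<and>
      cut_connected (\<lambda>x y. f x y = q) V"
    then have conn: "cut_connected (\<lambda>x y. f x y = r) V" "cut_connected (\<lambda>x y. f x y = p) V"
      "cut_connected (\<lambda>x y. f x y = q) V" by auto
    show False
    proof (cases "card V = 2")
      case True
      then obtain w where w: "V = {v, w}" "v \<noteq> w" using v by (auto simp: card_2_iff)
      then have "f v w = r" "f v w = p"
        using cut_connectedD[OF conn(1), of "{v}"] cut_connectedD[OF conn(2), of "{v}"] by auto
      then show False using distinct by simp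
    next
      case False
      then have "2 \<le> card (V - {v})" using psubset.prems(1) v psubset.hyps by simp
      moreover have "V - {v} \<subset> V" using v by blast
      moreover have "\<And>x y z. x \<in> V - {v} \<Longrightarrow> y \<in> V - {v} \<Longrightarrow> z \<in> V - {v} \<Longrightarrow>
          f x y = f y z \<or> f y z = f x z \<or> f x y = f x z"
        using psubset.prems(2) by blast
      ultimately have "\<not> (cut_connected (\<lambda>x y. f x y = r) (V - {v}) \<and>
          cut_connected (\<lambda>x y. f x y = p) (V - {v}) \<and> cut_connected (\<lambda>x y. f x y = q) (V - {v}))"
        using psubset.IH by blast
      moreover have "cut_connected (\<lambda>x y. f x y = r) (V - {v})"
        by (rule rainbow_free_connected_remove[where p = p and q = q])
          (use sym psubset.prems distinct conn v in auto)
      moreover have "cut_connected (\<lambda>x y. f x y = p) (V - {v})"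
        by (rule rainbow_free_connected_remove[where p = r and q = q])
          (use sym psubset.prems distinct conn v in auto)
      moreover have "cut_connected (\<lambda>x y. f x y = q) (V - {v})"
        by (rule rainbow_free_connected_remove[where p = r and q = p])
          (use sym psubset.prems distinct conn v in auto)
      ultimately show False by blast
    qed
  qed
qed

section \<open>Forcing classes of edges\<close>

context pair_graph
begin

abbreviation adj :: "'a \<Rightarrow> 'a \<Rightarrow> bool" where
  "adj x y \<equiv> (x, y) \<in> parcs G"

lemma adj_sym: "adj x y \<Longrightarrow> adj y x"
  using arcs_symmetric by blast

lemma adj_irrefl: "\<not> adj x x"
  using pair_no_loops by force

lemma edgesE:
  assumes "e \<in> edges G"
  obtains x y where "e = {x, y}" "adj x y"
  using assms by (auto simp: edges_def)

text \<open>Related edges must share their colour, since different colours would make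
  \<open>x\<close> and \<open>z\<close> adjacent. This is the unoriented form of Gallai's forcing
  relation for transitive orientations. The case \<open>z = x\<close> relates every edge to
  itself.\<close>

definition forcing :: "'a set rel" where
  "forcing = {({x, y}, {y, z}) | x y z. adj x y \<and> adj y z \<and> \<not> adj x z}"

lemma forcingI: "adj x y \<Longrightarrow> adj y z \<Longrightarrow> \<not> adj x z \<Longrightarrow> ({x, y}, {y, z}) \<in> forcing"
  by (auto simp: forcing_def)

lemma forcingE:
  assumes "(e, e') \<in> forcing"
  obtains x y z where "e = {x, y}" "e' = {y, z}" "adj x y" "adj y z" "\<not> adj x z"
  using assms by (auto simp: forcing_def)

lemma sym_forcing: "sym forcing"
proof (rule symI)
  fix e e' assume "(e, e') \<in> forcing"
  then obtain x y z where *: "e = {x, y}" "e' = {y, z}" "adj x y" "adj y z" "\<not> adj x z"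
    by (rule forcingE)
  then have "({z, y}, {y, x}) \<in> forcing" by (intro forcingI) (auto dest: adj_sym)
  then show "(e', e) \<in> forcing" using * by (simp add: insert_commute)
qed

text \<open>As \<open>forcing\<close> is symmetric, these are the unions of forcing classes of
  edges.\<close>

definition force_closed :: "'a set set \<Rightarrow> bool" where
  "force_closed U \<longleftrightarrow> U \<subseteq> edges G \<and> (\<forall>(e, e') \<in> forcing. e \<in> U \<longrightarrow> e' \<in> U)"

lemma force_closedD: "force_closed U \<Longrightarrow> (e, e') \<in> forcing \<Longrightarrow> e \<in> U \<Longrightarrow> e' \<in> U"
  by (auto simp: force_closed_def)

lemma force_closed_triple:
  assumes "force_closed U" "{x, y} \<in> U" "adj y z" "\<not> adj x z"
  shows "{y, z} \<in> U"
proof -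
  have "adj x y" using assms(1,2) doubleton_in_edges_iff by (auto simp: force_closed_def)
  then show ?thesis using force_closedD forcingI assms by blast
qed

lemma force_closed_compl:
  assumes "force_closed U"
  shows "force_closed (edges G - U)"
proof -
  have "e' \<in> edges G - U" if "(e, e') \<in> forcing" "e \<in> edges G - U" for e e'
  proof -
    have "e' \<in> edges G" using that(1) by (auto simp: forcing_def edges_def)
    moreover have "e' \<notin> U" using that sym_forcing force_closedD[OF assms] by (meson DiffD2 symD)
    ultimately show ?thesis by blast
  qed
  then show ?thesis by (auto simp: force_closed_def)
qed

definition force_class :: "'a set \<Rightarrow> 'a set set" where
  "force_class e = forcing\<^sup>* `` {e}"

lemma self_in_force_class: "e \<in> force_class e"
  by (simp add: force_class_def)

text \<open>Serves as the induction principle for classes: a class lies in any closed set that it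
  meets.\<close>

lemma force_class_least:
  assumes "force_closed U" "e \<in> U"
  shows "force_class e \<subseteq> U"
proof
  fix e' assume "e' \<in> force_class e"
  then have "(e, e') \<in> forcing\<^sup>*" by (simp add: force_class_def)
  then show "e' \<in> U" by (induction rule: rtrancl_induct) (use assms force_closedD in auto)
qed

lemma force_closed_edges: "force_closed (edges G)"
  by (auto simp: force_closed_def forcing_def edges_def)

lemma force_closed_force_class:
  assumes "e \<in> edges G"
  shows "force_closed (force_class e)"
  using force_class_least[OF force_closed_edges assms]
  by (auto simp: force_closed_def force_class_def intro: rtrancl_into_rtrancl)

lemma force_class_eq:
  assumes "e' \<in> force_class e"
  shows "force_class e' = force_class e"
proof -
  have "(e, e') \<in> forcing\<^sup>*" using assms by (simp add: force_class_def)
  moreover have "(e', e) \<in> forcing\<^sup>*"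
    using calculation sym_rtrancl[OF sym_forcing] by (meson symD)
  ultimately show ?thesis by (auto simp: force_class_def)
qed

section \<open>Colourings as unions of forcing classes\<close>

definition force_splits :: "'a set set set" where
  "force_splits = {U. force_closed U \<and> U \<noteq> {} \<and> U \<noteq> edges G}"

lemma qt_colouring_iff:
  "qt_colouring G c \<longleftrightarrow> c \<in> edges G \<rightarrow>\<^sub>E UNIV \<and> (\<forall>(e, e') \<in> forcing. c e = c e')"
proof -
  have "(\<forall>x y z. {x, y} \<in> edges G \<and> {y, z} \<in> edges G \<and> c {x, y} \<noteq> c {y, z} \<longrightarrow> {x, z} \<in> edges G)
    \<longleftrightarrow> (\<forall>(e, e') \<in> forcing. c e = c e')"
    unfolding doubleton_in_edges_iff forcing_def by blast
  then show ?thesis unfolding qt_colouring_def by blast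
qed

text \<open>A colouring is determined by its red edges, as extensionality fixes it elsewhere.
  Constancy along \<open>forcing\<close> makes the red set closed, and nontriviality makes it
  nonempty and proper.\<close>

lemma bij_betw_colourings_force_splits:
  "bij_betw (\<lambda>c. {e \<in> edges G. c e = Red})
    {c. qt_colouring G c \<and> \<not> trivial_colouring G c} force_splits"
proof (rule bij_betw_byWitness[where f' = "\<lambda>U. \<lambda>e\<in>edges G. if e \<in> U then Red else Blue"])
  have col: "k \<noteq> Red \<longleftrightarrow> k = Blue" for k by (cases k) auto
  show "\<forall>c \<in> {c. qt_colouring G c \<and> \<not> trivial_colouring G c}.
      (\<lambda>e\<in>edges G. if e \<in> {e \<in> edges G. c e = Red} then Red else Blue) = c"
  proof (intro ballI ext)
    fix c e assume "c \<in> {c. qt_colouring G c \<and> \<not> trivial_colouring G c}"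
    then have "c \<in> edges G \<rightarrow>\<^sub>E UNIV" by (simp add: qt_colouring_def)
    then show "(\<lambda>e\<in>edges G. if e \<in> {e \<in> edges G. c e = Red} then Red else Blue) e = c e"
      using col[of "c e"] PiE_arb[of c "edges G" _ e] by (cases "e \<in> edges G") auto
  qed
  show "\<forall>U \<in> force_splits. {e \<in> edges G. (\<lambda>e\<in>edges G. if e \<in> U then Red else Blue) e = Red} = U"
    by (auto simp: force_splits_def force_closed_def split: if_splits)
  show "(\<lambda>c. {e \<in> edges G. c e = Red}) ` {c. qt_colouring G c \<and> \<not> trivial_colouring G c}
      \<subseteq> force_splits"
  proof clarify
    fix c assume c: "qt_colouring G c" "\<not> trivial_colouring G c"
    have "force_closed {e \<in> edges G. c e = Red}"
      using c(1) force_closedD[OF force_closed_edges]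
      unfolding qt_colouring_iff force_closed_def by fastforce
    moreover have "{e \<in> edges G. c e = Red} \<noteq> {}"
      using c(2) col unfolding trivial_colouring_def by blast
    moreover have "{e \<in> edges G. c e = Red} \<noteq> edges G"
      using c(2) unfolding trivial_colouring_def by blast
    ultimately show "{e \<in> edges G. c e = Red} \<in> force_splits" by (simp add: force_splits_def)
  qed
  show "(\<lambda>U. \<lambda>e\<in>edges G. if e \<in> U then Red else Blue) ` force_splits
      \<subseteq> {c. qt_colouring G c \<and> \<not> trivial_colouring G c}"
  proof clarify
    fix U assume U: "U \<in> force_splits"
    let ?c = "\<lambda>e\<in>edges G. if e \<in> U then Red else Blue"
    have closed: "force_closed U" using U by (simp add: force_splits_def)
    have "?c e = ?c e'" if "(e, e') \<in> forcing" for e e'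
    proof -
      have "(e', e) \<in> forcing" using that sym_forcing by (meson symD)
      then have "e \<in> U \<longleftrightarrow> e' \<in> U" "e \<in> edges G \<longleftrightarrow> e' \<in> edges G"
        using that force_closedD closed force_closed_edges by blast+
      then show ?thesis by simp
    qed
    then have "qt_colouring G ?c"
      unfolding qt_colouring_iff by (intro conjI ballI restrict_PiE_iff[THEN iffD2]) blast+
    moreover have "\<not> trivial_colouring G ?c"
    proof
      assume "trivial_colouring G ?c"
      then obtain k where k: "\<forall>e \<in> edges G. ?c e = k" unfolding trivial_colouring_def by blast
      obtain e e' where e: "e \<in> U" "e' \<in> edges G" "e' \<notin> U" "e \<in> edges G"
        using U by (auto simp: force_splits_def force_closed_def)
      then have "?c e = ?c e'" using k by metis
      then show False using e by simp
    qed
    ultimately show "qt_colouring G ?c \<and> \<not> trivial_colouring G ?c" ..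
  qed
qed

lemma uniquely_qt_colourable_iff: "uniquely_qt_colourable G \<longleftrightarrow> card force_splits = 2"
  unfolding uniquely_qt_colourable_def
  using bij_betw_same_card[OF bij_betw_colourings_force_splits] by simp

section \<open>Spans of classes and connected modules\<close>

text \<open>A forcing step keeps a common vertex. If no edge of the class crossed \<open>S\<close>,
  the class edges inside \<open>S\<close> would be closed, hence the whole class, and the span could
  not leave \<open>S\<close>.\<close>

lemma cut_connected_span:
  assumes "e \<in> edges G"
  shows "cut_connected (\<lambda>x y. {x, y} \<in> force_class e) (\<Union>(force_class e))"
  unfolding cut_connected_def
proof (intro allI impI, rule ccontr)
  fix S assume S: "S \<subseteq> \<Union>(force_class e)" "S \<noteq> {}" "S \<noteq> \<Union>(force_class e)"
    and no: "\<not> (\<exists>x\<in>S. \<exists>y\<in>\<Union>(force_class e) - S. {x, y} \<in> force_class e)"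
  have same: "x \<in> S \<longleftrightarrow> y \<in> S" if "{x, y} \<in> force_class e" for x y
  proof -
    have "{y, x} \<in> force_class e" "x \<in> \<Union>(force_class e)" "y \<in> \<Union>(force_class e)"
      using that by (auto simp: insert_commute)
    then show ?thesis using no that by blast
  qed
  note closed = force_closed_force_class[OF assms]
  have "force_closed {d \<in> force_class e. d \<subseteq> S}"
    unfolding force_closed_def
  proof (intro conjI ballI, goal_cases)
    case 1
    then show ?case using closed by (auto simp: force_closed_def)
  next
    case (2 p)
    then obtain x y z where "p = ({x, y}, {y, z})" "adj y z" "\<not> adj x z"
      by (auto simp: forcing_def)
    then show ?case using force_closed_triple[OF closed, of x y z] same[of y z] by auto
  qed
  moreover obtain s d where sd: "s \<in> S" "s \<in> d" "d \<in> force_class e" using S by blast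
  moreover have "d \<subseteq> S"
  proof -
    have "d \<in> edges G" using sd closed by (auto simp: force_closed_def)
    then obtain x y where "d = {x, y}" by (rule edgesE)
    then show ?thesis using sd same by auto
  qed
  ultimately have "force_class d \<subseteq> {d \<in> force_class e. d \<subseteq> S}"
    by (intro force_class_least) auto
  then have "\<Union>(force_class e) \<subseteq> S" using force_class_eq[OF sd(3)] by blast
  then show False using S by blast
qed

text \<open>If \<open>u\<close> is adjacent to \<open>x\<close> but not to \<open>y\<close> and
  \<open>xy\<close> is in the class, then \<open>xy\<close> forces \<open>ux\<close>, putting
  \<open>u\<close> into the span. So adjacency to an outside vertex spreads along class edges, and
  these connect the span.\<close>

lemma span_homogeneous:
  assumes e: "e \<in> edges G" and u: "u \<notin> \<Union>(force_class e)"
    and v: "v \<in> \<Union>(force_class e)" "adj u v" and w: "w \<in> \<Union>(force_class e)"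
  shows "adj u w"
proof -
  note closed = force_closed_force_class[OF e]
  have next_adj: "adj u y" if "{x, y} \<in> force_class e" "adj u x" for x y
  proof (rule ccontr)
    assume "\<not> adj u y"
    then have "{x, u} \<in> force_class e"
      using force_closed_triple[OF closed, of y x u] that adj_sym by (metis insert_commute)
    then show False using u by blast
  qed
  let ?S = "{x \<in> \<Union>(force_class e). adj u x}"
  have "?S = \<Union>(force_class e)"
  proof (rule ccontr)
    assume "?S \<noteq> \<Union>(force_class e)"
    moreover have "?S \<subseteq> \<Union>(force_class e)" "?S \<noteq> {}" using v by blast+
    ultimately obtain x y where "x \<in> ?S" "y \<in> \<Union>(force_class e)" "y \<notin> ?S" "{x, y} \<in> force_class e"
      using cut_connectedD[OF cut_connected_span[OF e]] by blast
    then show False using next_adj by blast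
  qed
  then show ?thesis using w by blast
qed

lemma span_subset_verts:
  assumes "e \<in> edges G"
  shows "\<Union>(force_class e) \<subseteq> pverts G"
proof -
  have "\<Union>(force_class e) \<subseteq> \<Union>(edges G)"
    using force_class_least[OF force_closed_edges assms] by (rule Union_mono)
  also have "\<dots> \<subseteq> pverts G" by (auto simp: edges_def dest: in_arcsD1 in_arcsD2)
  finally show ?thesis .
qed

lemma card_span_ge_2:
  assumes "e \<in> edges G"
  shows "2 \<le> card (\<Union>(force_class e))"
proof -
  obtain x y where xy: "e = {x, y}" "adj x y" using assms by (rule edgesE)
  then have "card e = 2" using adj_irrefl by (metis card_2_iff)
  moreover have "finite (\<Union>(force_class e))"
    using span_subset_verts[OF assms] pair_finite_verts finite_subset by blast
  moreover have "e \<subseteq> \<Union>(force_class e)" using self_in_force_class by blast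
  ultimately show ?thesis by (metis card_mono)
qed

section \<open>Distinct forcing classes have distinct spans\<close>

theorem force_class_eq_if_span_eq:
  assumes e: "e \<in> edges G" "e' \<in> edges G"
    and span: "\<Union>(force_class e) = \<Union>(force_class e')"
  shows "force_class e = force_class e'"
proof (rule ccontr)
  assume "force_class e \<noteq> force_class e'"
  then have disj: "force_class e \<inter> force_class e' = {}" using force_class_eq by blast
  define W where "W = \<Union>(force_class e)"
  note closed = force_closed_force_class[OF e(1)] force_closed_force_class[OF e(2)]
  have class_adj: "adj x y" if "{x, y} \<in> force_class e \<union> force_class e'" for x y
    using that closed doubleton_in_edges_iff by (auto simp: force_closed_def)
  \<comment> \<open>Colour 0 is for non-edges, 1 for the class of \<open>e\<close>, and 2 for all
    other edges, among them the class of \<open>e'\<close>.\<close>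
  define f :: "'a \<Rightarrow> 'a \<Rightarrow> nat" where
    "f x y = (if \<not> adj x y then 0 else if {x, y} \<in> force_class e then 1 else 2)" for x y
  have f_sym: "f x y = f y x" for x y
    using adj_sym by (auto simp: f_def insert_commute)
  have f_triple: "{y, z} \<in> force_class e \<longleftrightarrow> {x, y} \<in> force_class e"
    if "adj x y" "adj y z" "\<not> adj x z" for x y z
    using that force_closed_triple[OF closed(1), of x y z] force_closed_triple[OF closed(1), of z y x]
      adj_sym by (metis insert_commute)
  \<comment> \<open>A rainbow triangle would contain exactly one non-edge, and its two edges would
    then force each other into the same class.\<close>
  have rainbow_free: "f x y = f y z \<or> f y z = f x z \<or> f x y = f x z" for x y z
  proof -
    have "f x y = f y z" if "adj x y" "adj y z" "\<not> adj x z" for x y z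
      using f_triple[OF that] that by (simp add: f_def)
    note this[of x y z] this[of y x z] this[of x z y]
    then show ?thesis using f_sym adj_sym
      by (smt (verit, best) f_def)
  qed
  have "cut_connected (\<lambda>x y. f x y = 1) W"
    unfolding W_def by (rule cut_connected_mono[OF cut_connected_span[OF e(1)]])
      (use class_adj in \<open>auto simp: f_def\<close>)
  moreover have "cut_connected (\<lambda>x y. f x y = 2) W"
    unfolding W_def span by (rule cut_connected_mono[OF cut_connected_span[OF e(2)]])
      (use class_adj disj in \<open>auto simp: f_def\<close>)
  moreover have "finite W" "2 \<le> card W"
    using span_subset_verts[OF e(1)] pair_finite_verts finite_subset card_span_ge_2[OF e(1)]
    unfolding W_def by blast+
  ultimately have "\<not> cut_connected (\<lambda>x y. f x y = 0) W"
    using rainbow_free_imp_disconnected[of W f 0 1 2] f_sym rainbow_free by auto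
  then obtain S where S: "S \<subseteq> W" "S \<noteq> {}" "S \<noteq> W"
    and no_cut: "\<not> (\<exists>x\<in>S. \<exists>y\<in>W - S. f x y = 0)"
    unfolding cut_connected_def by blast
  have S_adj: "adj x y" if "x \<in> S" "y \<in> W - S" for x y
  proof (rule ccontr)
    assume "\<not> adj x y"
    then have "f x y = 0" by (simp add: f_def)
    then show False using no_cut that by blast
  qed
  \<comment> \<open>The classes of \<open>N\<^sup>*\<close> on \<open>W\<close> are the
    co-components, that is, the components of the complement graph; vertices of different
    co-components are adjacent.\<close>
  define N where "N = {(x, y). x \<in> W \<and> y \<in> W \<and> \<not> adj x y}"
  have "sym N" using adj_sym by (auto simp: N_def sym_def)
  then have N_sym: "(y, x) \<in> N\<^sup>*" if "(x, y) \<in> N\<^sup>*" for x y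
    using that sym_rtrancl by (meson symD)
  have N_in: "y \<in> W" if "(x, y) \<in> N\<^sup>*" "x \<in> W" for x y
    using that by (induction rule: rtrancl_induct) (auto simp: N_def)
  have joined: "adj x y" if "x \<in> W" "y \<in> W" "(x, y) \<notin> N\<^sup>*" for x y
    using that by (auto simp: N_def)
  \<comment> \<open>Moving one end of an edge along a non-edge, while the other end stays in a
    different co-component, is a forcing step.\<close>
  have spread: "{x', y} \<in> C"
    if C: "force_closed C" "{x, y} \<in> C" and x: "(x, x') \<in> N\<^sup>*" "x \<in> W" "y \<in> W" "(x, y) \<notin> N\<^sup>*"
    for C x x' y
    using x(1)
  proof (induction rule: rtrancl_induct)
    case (step x1 x2)
    have "(x2, y) \<notin> N\<^sup>*" using step(1,2) x(4) by (meson rtrancl_trans r_into_rtrancl)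
    then have "adj x2 y" using joined x(3) step(2) by (auto simp: N_def)
    moreover have "\<not> adj x1 x2" using step(2) by (simp add: N_def)
    ultimately show ?case
      using force_closed_triple[OF C(1) step(3), of x2] adj_sym by (simp add: insert_commute)
  qed (use C in simp)
  obtain s where s: "s \<in> S" "s \<in> W" using S by blast
  \<comment> \<open>All pairs across the cut \<open>S\<close> are adjacent, so the co-component of
    \<open>s\<close> stays inside \<open>S\<close> and is not all of \<open>W\<close>. Each of the
    two classes is connected on \<open>W\<close> and hence has an edge leaving
    \<open>P\<close>.\<close>
  define P where "P = N\<^sup>* `` {s}"
  have "P \<subseteq> S"
  proof
    fix x assume "x \<in> P"
    then have "(s, x) \<in> N\<^sup>*" by (simp add: P_def)
    then show "x \<in> S" by (induction rule: rtrancl_induct) (use s S_adj in \<open>auto simp: N_def\<close>)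
  qed
  then have P: "P \<subseteq> W" "P \<noteq> {}" "P \<noteq> W" using S by (auto simp: P_def)
  obtain p q where pq: "p \<in> P" "q \<in> W" "q \<notin> P" "{p, q} \<in> force_class e"
    using cut_connectedD[OF cut_connected_span[OF e(1)], of P] P unfolding W_def by metis
  obtain p' q' where pq': "p' \<in> P" "q' \<in> W" "q' \<notin> P" "{p', q'} \<in> force_class e'"
    using cut_connectedD[OF cut_connected_span[OF e(2)], of P] P unfolding W_def span by metis
  have P_rel: "(x, y) \<in> N\<^sup>* \<longleftrightarrow> y \<in> P" if "x \<in> P" for x y
    using that N_sym unfolding P_def by (meson Image_singleton_iff rtrancl_trans)
  define Q where "Q = N\<^sup>* `` {q}"
  have Q_P: "y \<in> W" "y \<notin> P" if "y \<in> Q" for y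
    using that pq N_in N_sym P_rel unfolding Q_def by (blast, blast)
  \<comment> \<open>First the end \<open>p\<close> moves within \<open>P\<close>, then the end
    \<open>q\<close> within its co-component \<open>Q\<close>.\<close>
  have PQ: "{x, y} \<in> force_class e" if "x \<in> P" "y \<in> Q" for x y
  proof -
    have "{x, q} \<in> force_class e"
      using spread[OF closed(1) pq(4), of x] P_rel that(1) pq P(1) by blast
    moreover have "(q, x) \<notin> N\<^sup>*" using N_sym P_rel that(1) pq by blast
    ultimately have "{y, x} \<in> force_class e"
      using spread[OF closed(1), of q x y] that P(1) pq
      by (auto simp: Q_def insert_commute)
    then show ?thesis by (simp add: insert_commute)
  qed
  \<comment> \<open>\<open>K\<close> is closed because a forced edge replaces an end by a vertex not
    adjacent to it, which lies in the same co-component. So the class of \<open>e\<close> runs only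
    between \<open>P\<close> and \<open>Q\<close>.\<close>
  define K where "K = {d \<in> force_class e. \<exists>x \<in> P. \<exists>y \<in> Q. d = {x, y}}"
  have "force_closed K"
    unfolding force_closed_def
  proof (intro conjI ballI, goal_cases)
    case 1
    then show ?case using closed by (auto simp: force_closed_def K_def)
  next
    case (2 d)
    show ?case
    proof (clarsimp split: prod.splits)
      fix d1 d2 assume "d = (d1, d2)" "d1 \<in> K"
      with 2 obtain x y z where d: "d1 = {x, y}" "d2 = {y, z}" "adj y z" "\<not> adj x z" "{x, y} \<in> K"
        using forcingE by metis
      then have d2: "{y, z} \<in> force_class e"
        using force_closed_triple[OF closed(1)] by (auto simp: K_def)
      then have z: "z \<in> W" by (auto simp: W_def)
      have "x \<in> P \<and> y \<in> Q \<or> x \<in> Q \<and> y \<in> P" using d(5) by (auto simp: K_def doubleton_eq_iff)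
      then have "z \<in> P \<and> y \<in> Q \<or> z \<in> Q \<and> y \<in> P"
      proof
        assume xy: "x \<in> P \<and> y \<in> Q"
        then have "(x, z) \<in> N" using d z P by (auto simp: N_def)
        then show ?thesis using xy P_rel by blast
      next
        assume xy: "x \<in> Q \<and> y \<in> P"
        then have "(x, z) \<in> N" using d z Q_P by (auto simp: N_def)
        then show ?thesis using xy by (auto simp: Q_def intro: rtrancl_into_rtrancl)
      qed
      then show "d2 \<in> K" using d(2) d2 unfolding K_def by (auto simp: insert_commute)
    qed
  qed
  moreover have "{p, q} \<in> K" using pq by (auto simp: K_def Q_def)
  ultimately have "force_class e \<subseteq> K"
    using force_class_least force_class_eq[OF pq(4)] by blast
  \<comment> \<open>With no third co-component, the edge of the other class leaving \<open>P\<close>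
    ends in \<open>Q\<close>, where \<open>PQ\<close> has already assigned it to the class of
    \<open>e\<close>.\<close>
  then have "W \<subseteq> P \<union> Q" by (auto simp: W_def K_def)
  then have "q' \<in> Q" using pq' by blast
  then have "{p', q'} \<in> force_class e" using PQ pq' by blast
  then show False using pq' disj by blast
qed

section \<open>Connected modules and the edges inside them\<close>

definition conn_module :: "'a set \<Rightarrow> bool" where
  "conn_module M \<longleftrightarrow> M \<subset> pverts G \<and> cut_connected adj M \<and> 2 \<le> card M \<and>
    (\<forall>u \<in> pverts G - M. (\<exists>v \<in> M. adj u v) \<longrightarrow> (\<forall>v \<in> M. adj u v))"

lemma conn_module_span:
  assumes e: "e \<in> edges G" and "\<Union>(force_class e) \<noteq> pverts G"
  shows "conn_module (\<Union>(force_class e))"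
proof -
  have "cut_connected adj (\<Union>(force_class e))"
    by (rule cut_connected_mono[OF cut_connected_span[OF e]])
      (use force_closed_force_class[OF e] doubleton_in_edges_iff in \<open>auto simp: force_closed_def\<close>)
  then show ?thesis
    using span_subset_verts[OF e] card_span_ge_2[OF e] assms(2) span_homogeneous[OF e]
    unfolding conn_module_def by blast
qed

definition inner_edges :: "'a set \<Rightarrow> 'a set set" where
  "inner_edges M = {e \<in> edges G. e \<subseteq> M}"

text \<open>Being connected with at least two vertices, \<open>M\<close> gives each of its vertices
  a neighbour inside. A module can thus be recovered from its inner edges.\<close>

lemma Union_inner_edges:
  assumes "conn_module M"
  shows "\<Union>(inner_edges M) = M"
proof
  show "M \<subseteq> \<Union>(inner_edges M)"
  proof
    fix x assume x: "x \<in> M"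
    have "{x} \<noteq> M" using assms by (auto simp: conn_module_def)
    then obtain y where "y \<in> M" "adj x y"
      using cut_connectedD[of adj M "{x}"] assms x by (auto simp: conn_module_def)
    then have "{x, y} \<in> inner_edges M"
      using x doubleton_in_edges_iff by (auto simp: inner_edges_def)
    then show "x \<in> \<Union>(inner_edges M)" by blast
  qed
qed (auto simp: inner_edges_def)

text \<open>Forcing cannot leave \<open>M\<close>: a vertex \<open>z\<close> outside adjacent to
  \<open>y\<close> is by homogeneity adjacent to \<open>x\<close> too. Connectivity of the whole
  graph supplies an edge that is not inside \<open>M\<close>.\<close>

lemma inner_edges_in_force_splits:
  assumes conn: "cut_connected adj (pverts G)" and M: "conn_module M"
  shows "inner_edges M \<in> force_splits"
proof -
  have "M \<noteq> {}" using M by (auto simp: conn_module_def)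
  then have "inner_edges M \<noteq> {}" using Union_inner_edges[OF M] by auto
  moreover have "inner_edges M \<noteq> edges G"
  proof -
    obtain x y where "x \<in> M" "y \<notin> M" "adj x y"
      using cut_connectedD[OF conn, of M] M \<open>M \<noteq> {}\<close> by (auto simp: conn_module_def)
    then have "{x, y} \<in> edges G" "{x, y} \<notin> inner_edges M"
      using doubleton_in_edges_iff by (auto simp: inner_edges_def)
    then show ?thesis by blast
  qed
  moreover have "force_closed (inner_edges M)"
    unfolding force_closed_def
  proof (intro conjI ballI, goal_cases)
    case (2 d)
    then obtain x y z where d: "d = ({x, y}, {y, z})" "adj x y" "adj y z" "\<not> adj x z"
      by (auto simp: forcing_def)
    have "z \<in> M" if "x \<in> M" "y \<in> M"
    proof (rule ccontr)
      assume "z \<notin> M"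
      moreover have "z \<in> pverts G" using d(3) by (rule in_arcsD2)
      ultimately have "adj z x" using M that adj_sym[OF d(3)] by (auto simp: conn_module_def)
      then show False using d(4) adj_sym by blast
    qed
    then show ?case using d doubleton_in_edges_iff by (auto simp: inner_edges_def)
  qed (auto simp: inner_edges_def)
  ultimately show ?thesis by (simp add: force_splits_def)
qed

text \<open>Otherwise every edge lies inside \<open>M\<close> or inside \<open>M'\<close>. But an
  edge of \<open>M\<close> leaving \<open>M'\<close> at \<open>x\<close> makes \<open>x\<close>
  adjacent to all of \<open>M'\<close>, including a vertex \<open>z\<close> outside
  \<open>M\<close>, and the edge \<open>xz\<close> lies in neither. This excludes the second split
  as the source of another module.\<close>

lemma conn_modules_not_complementary:
  assumes conn: "cut_connected adj (pverts G)" and M: "conn_module M" and M': "conn_module M'"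
  shows "inner_edges M' \<noteq> edges G - inner_edges M"
proof
  assume compl: "inner_edges M' = edges G - inner_edges M"
  have inside: "x \<in> M \<and> y \<in> M \<or> x \<in> M' \<and> y \<in> M'" if "adj x y" for x y
  proof -
    have "{x, y} \<in> inner_edges M \<or> {x, y} \<in> inner_edges M'"
      using that compl doubleton_in_edges_iff by blast
    then show ?thesis by (auto simp: inner_edges_def)
  qed
  have sub: "M \<subset> pverts G" "M' \<subset> pverts G" and ne: "M \<noteq> {}" "M' \<noteq> {}"
    using M M' by (auto simp: conn_module_def)
  have "\<not> M' \<subseteq> M"
  proof
    assume "M' \<subseteq> M"
    then have "inner_edges M' \<subseteq> inner_edges M" by (auto simp: inner_edges_def)
    then have "inner_edges M' = {}" using compl by blast
    then show False using inner_edges_in_force_splits[OF conn M'] by (simp add: force_splits_def)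
  qed
  then obtain z where z: "z \<in> M'" "z \<notin> M" by blast
  have "M \<subseteq> pverts G" "M \<noteq> pverts G" using sub by auto
  then obtain a b where ab: "a \<in> M" "b \<notin> M" "adj a b"
    using cut_connectedD[OF conn, of M] ne by auto
  then have "M \<inter> M' \<noteq> {}" using inside by blast
  moreover have "M \<inter> M' \<noteq> M"
  proof
    assume "M \<inter> M' = M"
    then have "inner_edges M \<subseteq> inner_edges M'" by (auto simp: inner_edges_def)
    then have "inner_edges M = {}" using compl by blast
    then show False using inner_edges_in_force_splits[OF conn M] by (simp add: force_splits_def)
  qed
  moreover have "cut_connected adj M" using M by (simp add: conn_module_def)
  ultimately obtain y x where yx: "y \<in> M \<inter> M'" "x \<in> M" "x \<notin> M'" "adj y x"
    using cut_connectedD[of adj M "M \<inter> M'"] by blast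
  then have "adj x z" using M' z(1) sub adj_sym[OF yx(4)] by (auto simp: conn_module_def)
  then show False using inside yx z by blast
qed

section \<open>Two splits correspond to a unique connected module\<close>

theorem card_force_splits_eq_2_iff:
  assumes conn: "cut_connected adj (pverts G)"
  shows "card force_splits = 2 \<longleftrightarrow> (\<exists>!M. conn_module M)"
proof
  assume card: "card force_splits = 2"
  then obtain U where U: "U \<in> force_splits" by fastforce
  have U_ne: "U \<noteq> {}" "U \<noteq> edges G" "U \<subseteq> edges G" "force_closed U"
    using U by (auto simp: force_splits_def force_closed_def)
  have "edges G - U \<in> force_splits" "U \<noteq> edges G - U"
    using U_ne force_closed_compl by (auto simp: force_splits_def)
  then have splits: "force_splits = {U, edges G - U}"
    using card U by (auto simp: card_2_iff)
  obtain e e' where e: "e \<in> U" "e' \<in> edges G" "e' \<notin> U" "e \<in> edges G" using U_ne by blast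
  have "force_class e \<subseteq> U" using U_ne e force_class_least by blast
  then have "force_class e \<noteq> force_class e'" using self_in_force_class e by blast
  \<comment> \<open>Different classes have different spans, so at most one of them spans all
    vertices; the other one yields a connected module.\<close>
  then have "\<Union>(force_class e) \<noteq> pverts G \<or> \<Union>(force_class e') \<noteq> pverts G"
    using force_class_eq_if_span_eq[OF e(4,2)] by auto
  then obtain M where M: "conn_module M"
    using conn_module_span[OF e(4)] conn_module_span[OF e(2)] by blast
  show "\<exists>!M. conn_module M"
  proof (rule ex1I[of _ M])
    fix M' assume M': "conn_module M'"
    have "inner_edges M \<in> {U, edges G - U}" "inner_edges M' \<in> {U, edges G - U}"
      using inner_edges_in_force_splits[OF conn] M M' splits by blast+
    then have "inner_edges M' \<in> {inner_edges M, edges G - inner_edges M}"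
      using double_diff[OF U_ne(3) order_refl] by auto
    then have "inner_edges M' = inner_edges M"
      using conn_modules_not_complementary[OF conn M M'] by blast
    then show "M' = M" using Union_inner_edges M M' by metis
  qed (rule M)
next
  assume "\<exists>!M. conn_module M"
  then obtain M where M: "conn_module M" and unique: "\<And>M'. conn_module M' \<Longrightarrow> M' = M" by blast
  define U where "U = inner_edges M"
  have U: "U \<in> force_splits" unfolding U_def by (rule inner_edges_in_force_splits[OF conn M])
  then have U_ne: "U \<noteq> {}" "U \<noteq> edges G" "U \<subseteq> edges G" "force_closed U"
    by (auto simp: force_splits_def force_closed_def)
  \<comment> \<open>Only two spans are possible. Those inside \<open>U\<close> are \<open>M\<close>
    and those outside turn out to be all of \<open>pverts G\<close>, so injectivity of the span
    leaves one class on each side.\<close>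
  have span: "\<Union>(force_class e) = M \<or> \<Union>(force_class e) = pverts G" if "e \<in> edges G" for e
    using unique conn_module_span that by blast
  have span_in: "\<Union>(force_class e) = M" if "e \<in> U" for e
  proof -
    have "\<Union>(force_class e) \<subseteq> M"
      using force_class_least[OF U_ne(4) that] by (auto simp: U_def inner_edges_def)
    then show ?thesis using span[of e] that U_ne M by (auto simp: conn_module_def)
  qed
  have class_in: "force_class e1 = force_class e2" if "e1 \<in> U" "e2 \<in> U" for e1 e2
    by (rule force_class_eq_if_span_eq) (use span_in that U_ne(3) in auto)
  obtain e0 where e0: "e0 \<in> U" using U_ne by blast
  \<comment> \<open>A class outside \<open>U\<close> with span \<open>M\<close> would coincide with
    the class of \<open>e0\<close>, which lies inside \<open>U\<close>.\<close>
  have span_out: "\<Union>(force_class e) = pverts G" if "e \<in> edges G - U" for e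
  proof (rule ccontr)
    assume "\<Union>(force_class e) \<noteq> pverts G"
    then have "\<Union>(force_class e) = \<Union>(force_class e0)"
      using span[of e] that span_in[OF e0] by simp
    then have "force_class e = force_class e0"
      by (rule force_class_eq_if_span_eq[rotated 2]) (use e0 that U_ne(3) in auto)
    then have "e \<in> U" using force_class_least[OF U_ne(4) e0] self_in_force_class by blast
    then show False using that by blast
  qed
  have class_out: "force_class e1 = force_class e2" if "e1 \<in> edges G - U" "e2 \<in> edges G - U" for e1 e2
    by (rule force_class_eq_if_span_eq) (use span_out that in auto)
  have "force_splits = {U, edges G - U}"
  proof (intro equalityI subsetI)
    fix X assume "X \<in> force_splits"
    then have X: "force_closed X" "X \<noteq> {}" "X \<noteq> edges G" "X \<subseteq> edges G"
      by (auto simp: force_splits_def force_closed_def)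
    have in_X: "e2 \<in> X" if "e1 \<in> X" "force_class e1 = force_class e2" for e1 e2
      using force_class_least[OF X(1) that(1)] that(2) self_in_force_class by blast
    have "U \<subseteq> X \<or> U \<inter> X = {}" using class_in in_X by blast
    moreover have "edges G - U \<subseteq> X \<or> (edges G - U) \<inter> X = {}" using class_out in_X by blast
    ultimately show "X \<in> {U, edges G - U}" using X U_ne(3) by blast
  next
    fix X assume "X \<in> {U, edges G - U}"
    then show "X \<in> force_splits"
      using U U_ne force_closed_compl by (auto simp: force_splits_def)
  qed
  moreover have "U \<noteq> edges G - U" using U_ne by blast
  ultimately show "card force_splits = 2" by simp
qed

section \<open>Translation to induced subgraphs\<close>

lemma induced_subgraph_with_proj_iff:
  "induced_subgraph (with_proj H) (with_proj G) \<longleftrightarrow>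
    pverts H \<subseteq> pverts G \<and> parcs H = parcs G \<inter> pverts H \<times> pverts H"
proof -
  have "wf_digraph (with_proj H)" if "parcs H = parcs G \<inter> pverts H \<times> pverts H"
  proof -
    have "pair_wf_digraph H"
      by (rule pair_wf_digraph.intro) (auto simp: that)
    then show ?thesis by (simp add: wf_digraph_wp_iff)
  qed
  moreover have "wf_digraph (with_proj G)" by unfold_locales
  ultimately show ?thesis
    by (auto simp: induced_subgraph_def subgraph_def)
qed

lemma induced_module_iff:
  "induced_subgraph (with_proj H) (with_proj G) \<and> H \<noteq> G \<and> connected (with_proj H) \<and>
    2 \<le> card (pverts H) \<and> card (pverts H) \<le> card (pverts G) - 1 \<and>
    (\<forall>u \<in> pverts G - pverts H.
      (\<exists>v \<in> pverts H. {u, v} \<in> edges G) \<longrightarrow> (\<forall>v \<in> pverts H. {u, v} \<in> edges G)) \<longleftrightarrow>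
   parcs H = parcs G \<inter> pverts H \<times> pverts H \<and> conn_module (pverts H)" (is "?L \<longleftrightarrow> ?R")
proof -
  let ?A = "parcs H = parcs G \<inter> pverts H \<times> pverts H"
  have conn: "connected (with_proj H) \<longleftrightarrow> pverts H \<noteq> {} \<and> cut_connected adj (pverts H)" if ?A
  proof -
    have "sym (parcs H)" using that adj_sym by (auto simp: sym_def)
    moreover have "cut_connected (\<lambda>x y. (x, y) \<in> parcs H) (pverts H) \<longleftrightarrow> cut_connected adj (pverts H)"
      using that by (auto elim!: cut_connected_mono)
    ultimately show ?thesis using connected_with_proj_iff by blast
  qed
  \<comment> \<open>The lower bound 2 keeps the truncated subtraction from making the inequality
    hold for equal vertex sets.\<close>
  have psub: "pverts H \<subset> pverts G \<longleftrightarrow> pverts H \<subseteq> pverts G \<and> card (pverts H) \<le> card (pverts G) - 1"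
    if "2 \<le> card (pverts H)"
    using that psubset_card_mono[OF pair_finite_verts, of "pverts H"] by fastforce
  have "pverts H \<noteq> {}" if "2 \<le> card (pverts H)" using that by auto
  moreover have "H \<noteq> G" if "pverts H \<subset> pverts G" using that by auto
  ultimately show ?thesis
    unfolding induced_subgraph_with_proj_iff doubleton_in_edges_iff conn_module_def
    using conn psub by (cases ?A) (simp, blast, simp)
qed

end

theorem theorem17:
  fixes G :: "'a pair_pre_digraph" and n :: nat
  assumes "pair_graph G"
    and "connected (with_proj G)"
    and "card (pverts G) = n"
  shows "uniquely_qt_colourable G \<longleftrightarrow>
    (\<exists>!H :: 'a pair_pre_digraph.
      induced_subgraph (with_proj H) (with_proj G) \<and> H \<noteq> G \<and>
      connected (with_proj H) \<and>
      2 \<le> card (pverts H) \<and> card (pverts H) \<le> n - 1 \<and>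
      (\<forall>u \<in> pverts G - pverts H.
        (\<exists>v \<in> pverts H. {u, v} \<in> edges G) \<longrightarrow> (\<forall>v \<in> pverts H. {u, v} \<in> edges G)))"
proof -
  interpret pair_graph G by fact
  have "sym (parcs G)" using adj_sym by (auto simp: sym_def)
  then have "cut_connected adj (pverts G)" using assms(2) connected_with_proj_iff by blast
  then have "uniquely_qt_colourable G \<longleftrightarrow> (\<exists>!M. conn_module M)"
    using uniquely_qt_colourable_iff card_force_splits_eq_2_iff by simp
  \<comment> \<open>An induced subgraph is determined by its vertex set, so unique existence passes
    between modules and the subgraphs they induce.\<close>
  also have "\<dots> \<longleftrightarrow>
      (\<exists>!H :: 'a pair_pre_digraph. parcs H = parcs G \<inter> pverts H \<times> pverts H \<and> conn_module (pverts H))"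
  proof
    assume "\<exists>!M. conn_module M"
    then obtain M where M: "conn_module M" "\<And>M'. conn_module M' \<Longrightarrow> M' = M" by blast
    show "\<exists>!H :: 'a pair_pre_digraph. parcs H = parcs G \<inter> pverts H \<times> pverts H \<and> conn_module (pverts H)"
    proof (rule ex1I[of _ "\<lparr>pverts = M, parcs = parcs G \<inter> M \<times> M\<rparr>"])
      fix H :: "'a pair_pre_digraph"
      assume H: "parcs H = parcs G \<inter> pverts H \<times> pverts H \<and> conn_module (pverts H)"
      then have "pverts H = M" using M(2) by blast
      then show "H = \<lparr>pverts = M, parcs = parcs G \<inter> M \<times> M\<rparr>"
        using H by (cases H) auto
    qed (use M(1) in simp)
  next
    assume "\<exists>!H :: 'a pair_pre_digraph. parcs H = parcs G \<inter> pverts H \<times> pverts H \<and> conn_module (pverts H)"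
    then obtain H :: "'a pair_pre_digraph" where H: "conn_module (pverts H)"
      and unique: "\<And>H' :: 'a pair_pre_digraph. parcs H' = parcs G \<inter> pverts H' \<times> pverts H' \<Longrightarrow>
        conn_module (pverts H') \<Longrightarrow> H' = H"
      by (elim ex1E) blast
    show "\<exists>!M. conn_module M"
    proof (rule ex1I[of _ "pverts H"])
      fix M assume "conn_module M"
      then show "M = pverts H"
        using unique[of "\<lparr>pverts = M, parcs = parcs G \<inter> M \<times> M\<rparr>"] by force
    qed (rule H)
  qed
  finally show ?thesis unfolding induced_module_iff[symmetric] assms(3) .
qed

end
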